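(* Let $n, m, k$ be positive integers. Let $F:\mathbb{N}\to\mathbb{C}$ be an arbitrary arithmetic function. For $1\le j\le m$ let $s_j\in\mathbb{Z}$ and let $\chi_j$ be a Dirichlet character (mod $n$) with conductor $d_j$ (so $d_j\mid n$), and let $\chi_j^*$ be the primitive character (mod $d_j$) that induces $\chi_j$. For $1\le \ell\le k$ let $w_\ell\in\mathbb{Z}$ and let $\lambda_\ell(b)=\exp(2\pi i w_\ell b/n)$. Then $$\sum_{a_1,\ldots,a_m,b_1,\ldots,b_k=1}^n F\big((a_1-s_1,\ldots,a_m-s_m,b_1,\ldots,b_k,n)\big)\,\chi_1(a_1)\cdots\chi_m(a_m)\,\lambda_1(b_1)\cdots\lambda_k(b_k)$$ $$=\varphi(n)^m\,\chi_1^*(s_1)\cdots\chi_m^*(s_m)\sum_{\substack{e\mid (n/d_1,\ldots,n/d_m,w_1,\ldots,w_k)\\ (n/e,\,s_1\cdots s_m)=1}}\frac{e^k\,(\mu*F)(n/e)}{\varphi(n/e)^m}.$$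
   Context: $\mathbb{N}=\{1,2,3,\ldots\}$. $(x_1,\ldots,x_r)$ denotes the (positive) greatest common divisor of integers $x_1,\ldots,x_r$, not all zero. An arithmetic function is a function $\mathbb{N}\to\mathbb{C}$. $\varphi$ is Euler's totient function, $\mu$ is the Möbius function, and $*$ is Dirichlet convolution: $(\mu*F)(q)=\sum_{\delta\mid q}\mu(\delta)F(q/\delta)$. Sums over divisors $e$ run over positive divisors. The primitive character $\chi^*$ (mod $d$) inducing a Dirichlet character $\chi$ (mod $n$) of conductor $d$ is the one satisfying $\chi(a)=\chi^*(a)$ if $(a,n)=1$ and $\chi(a)=0$ if $(a,n)>1$; for $d=1$, $\chi^*$ is identically $1$ on $\mathbb{Z}$. *)

theory Defs
  imports
    Complex_Main
    "HOL-Library.FuncSet"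
    "HOL-Computational_Algebra.Squarefree"
    "HOL-Number_Theory.Number_Theory"
begin

definition moebius_mu :: "nat \<Rightarrow> complex" where
  "moebius_mu q = (if squarefree q then (- 1) ^ card (prime_factors q) else 0)"

text \<open>Arithmetic functions are modelled by functions of type \<^typ>\<open>nat \<Rightarrow> complex\<close> whose value
  at \<open>0\<close> is irrelevant. Correspondingly, the convolution is only meaningful at positive
  arguments (at \<open>0\<close> the sum is over an infinite set, hence \<open>0\<close>).\<close>

definition dirichlet_conv :: "(nat \<Rightarrow> complex) \<Rightarrow> (nat \<Rightarrow> complex) \<Rightarrow> nat \<Rightarrow> complex" where
  "dirichlet_conv f g q = (\<Sum>\<delta> | \<delta> dvd q. f \<delta> * g (q div \<delta>))"

text \<open>Characters are functions on all integers, extended by \<open>0\<close> off the units modulo \<open>n\<close>.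
  The normalisation \<open>\<chi> 1 = 1\<close> follows from multiplicativity and \<open>\<chi> 1 \<noteq> 0\<close>.\<close>

definition dirichlet_character :: "nat \<Rightarrow> (int \<Rightarrow> complex) \<Rightarrow> bool" where
  "dirichlet_character n \<chi> \<longleftrightarrow>
     n > 0 \<and>
     (\<forall>a b. \<chi> (a * b) = \<chi> a * \<chi> b) \<and>
     (\<forall>a b. [a = b] (mod int n) \<longrightarrow> \<chi> a = \<chi> b) \<and>
     (\<forall>a. \<chi> a = 0 \<longleftrightarrow> \<not> coprime a (int n))"

definition induced_modulus :: "nat \<Rightarrow> (int \<Rightarrow> complex) \<Rightarrow> nat \<Rightarrow> bool" where
  "induced_modulus n \<chi> d \<longleftrightarrow>
     d dvd n \<and> (\<forall>a. coprime a (int n) \<and> [a = 1] (mod int d) \<longrightarrow> \<chi> a = 1)"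

definition conductor :: "nat \<Rightarrow> (int \<Rightarrow> complex) \<Rightarrow> nat" where
  "conductor n \<chi> = (LEAST d. induced_modulus n \<chi> d)"

text \<open>For \<open>n = 1\<close> the only character is the constant \<open>1\<close>, and it counts as primitive.\<close>

definition primitive_character :: "nat \<Rightarrow> (int \<Rightarrow> complex) \<Rightarrow> bool" where
  "primitive_character n \<chi> \<longleftrightarrow>
     dirichlet_character n \<chi> \<and> (\<forall>d<n. \<not> induced_modulus n \<chi> d)"

text \<open>\<open>\<chi>'\<close>, a character whose modulus divides \<open>n\<close>, induces the character \<open>\<chi>\<close> modulo \<open>n\<close>.\<close>

definition induces :: "(int \<Rightarrow> complex) \<Rightarrow> nat \<Rightarrow> (int \<Rightarrow> complex) \<Rightarrow> bool" where
  "induces \<chi>' n \<chi> \<longleftrightarrow> (\<forall>a. \<chi> a = (if coprime a (int n) then \<chi>' a else 0))"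

end

theory Submission
  imports Defs
begin

text \<open>Moebius inversion writes \<open>F g\<close> as the sum of \<open>(\<mu> * F) q\<close> over the divisors \<open>q\<close> of \<open>g\<close>. After
  exchanging summations, the sum over \<open>q dvd n\<close> of \<open>(\<mu> * F) q\<close> factors into sums in one variable:
  sums of \<open>\<chi>\<^sub>j\<close> over the class of \<open>s\<^sub>j\<close> modulo \<open>q\<close>, and sums of \<open>\<lambda>\<^sub>l\<close> over the multiples of \<open>q\<close>.
  The former vanish unless \<open>q\<close> is an induced modulus of \<open>\<chi>\<^sub>j\<close>, that is, a multiple of the conductor,
  because otherwise a unit congruent to 1 modulo \<open>q\<close> with character value different from 1
  permutes the class; the latter are geometric. The claim is obtained by putting \<open>e = n div q\<close>.\<close>


section \<open>Residues in \<open>{1..int n}\<close>, multiplication by units, and lifting of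
  units\<close>

text \<open>The shift by 1 before and after reduction makes \<open>n\<close>, not 0, represent the
  zero class, in agreement with the range of summation of the theorem.\<close>

definition least_pos_residue :: "nat \<Rightarrow> int \<Rightarrow> int" where
  "least_pos_residue n x = (x - 1) mod int n + 1"

lemma least_pos_residue_mem: "n > 0 \<Longrightarrow> least_pos_residue n x \<in> {1..int n}"
  unfolding least_pos_residue_def by (simp add: add1_zle_eq)

lemma least_pos_residue_cong: "[least_pos_residue n x = x] (mod int n)"
  unfolding least_pos_residue_def cong_def by (simp add: mod_simps)

lemma least_pos_residue_eq_iff:
  assumes "y \<in> {1..int n}"
  shows "least_pos_residue n x = y \<longleftrightarrow> [x = y] (mod int n)"
proof
  assume "[x = y] (mod int n)"
  hence "[x - 1 = y - 1] (mod int n)" by (intro cong_diff) auto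
  hence "(x - 1) mod int n = (y - 1) mod int n" by (simp add: cong_def)
  also have "\<dots> = y - 1" using assms by simp
  finally show "least_pos_residue n x = y" by (simp add: least_pos_residue_def)
next
  assume "least_pos_residue n x = y"
  thus "[x = y] (mod int n)" using least_pos_residue_cong cong_sym by blast
qed

text \<open>Multiplication by a unit followed by reduction is an injective self-map of a finite set,
  hence a permutation; a periodic \<open>f\<close> does not see the reduction.\<close>

lemma sum_periodic_mult_unit:
  fixes f :: "int \<Rightarrow> 'a::comm_monoid_add"
  assumes n: "n > 0" and u: "coprime u (int n)"
    and per: "\<And>a b. [a = b] (mod int n) \<Longrightarrow> f a = f b"
  shows "(\<Sum>a\<in>{1..int n}. f (u * a)) = (\<Sum>a\<in>{1..int n}. f a)"
proof -
  let ?h = "\<lambda>a. least_pos_residue n (u * a)"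
  have inj: "inj_on ?h {1..int n}"
  proof (rule inj_onI)
    fix a b assume a: "a \<in> {1..int n}" and b: "b \<in> {1..int n}" and e: "?h a = ?h b"
    have "[u * a = u * b] (mod int n)"
      using e least_pos_residue_cong[of n] by (metis cong_sym cong_trans)
    hence "[a = b] (mod int n)" using u by (simp add: cong_mult_lcancel)
    hence "[a - 1 = b - 1] (mod int n)" by (intro cong_diff) auto
    thus "a = b" using a b by (simp add: cong_def)
  qed
  have "?h ` {1..int n} = {1..int n}"
    by (rule endo_inj_surj[OF _ _ inj]) (use least_pos_residue_mem[OF n] in auto)
  hence "(\<Sum>a\<in>{1..int n}. f a) = (\<Sum>a\<in>{1..int n}. f (?h a))"
    using sum.reindex[OF inj, of f] by simp
  also have "\<dots> = (\<Sum>a\<in>{1..int n}. f (u * a))"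
    by (intro sum.cong refl per least_pos_residue_cong)
  finally show ?thesis by simp
qed

text \<open>Surjectivity of the reduction of units. Adding to \<open>s\<close> the multiple
  \<open>q * M\<close>, where \<open>M\<close> collects the primes of \<open>n\<close> not dividing
  \<open>s\<close>, makes every prime of \<open>n\<close> divide exactly one of the two summands: a
  prime dividing \<open>s\<close> divides neither \<open>q\<close> nor \<open>M\<close>.\<close>

lemma coprime_lift:
  assumes n: "n > 0" and q: "q dvd n" and s: "coprime s (int q)"
  obtains t where "[t = s] (mod int q)" "coprime t (int n)"
proof -
  define M where "M = \<Prod>{p \<in> prime_factors n. \<not> int p dvd s}"
  let ?t = "s + int q * int M"
  have M: "p dvd M \<longleftrightarrow> \<not> int p dvd s" if p: "prime p" "p dvd n" for p
  proof
    assume "p dvd M"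
    then obtain r where r: "r \<in> prime_factors n" "\<not> int r dvd s" "p dvd r"
      unfolding M_def using p(1) prime_dvd_prod_iff[of "{p \<in> prime_factors n. \<not> int p dvd s}" p "\<lambda>x. x"]
      by auto
    thus "\<not> int p dvd s" using p(1) by (metis in_prime_factors_iff primes_dvd_imp_eq)
  next
    assume "\<not> int p dvd s"
    thus "p dvd M" unfolding M_def using p n dvd_prodI[of "{p \<in> prime_factors n. \<not> int p dvd s}" p "\<lambda>x. x"]
      by (auto simp: in_prime_factors_iff)
  qed
  have "coprime ?t (int n)"
  proof (rule ccontr)
    assume "\<not> coprime ?t (int n)"
    hence "gcd ?t (int n) \<noteq> 1" by (simp add: coprime_iff_gcd_eq_1)
    hence "nat (gcd ?t (int n)) \<noteq> 1" by simp
    then obtain p where p: "prime p" "p dvd nat (gcd ?t (int n))"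
      using prime_factor_nat by blast
    have "int p dvd gcd ?t (int n)" using p(2) by (metis gcd_ge_0_int int_dvd_int_iff int_nat_eq)
    hence p2: "int p dvd ?t" and pn: "p dvd n" by auto
    show False
    proof (cases "int p dvd s")
      case True
      hence "int p dvd int q * int M" using p2 by (simp add: dvd_add_right_iff)
      hence "p dvd q * M" by (metis int_dvd_int_iff of_nat_mult)
      hence "p dvd q" using M[OF p(1) pn] True p(1) by (simp add: prime_dvd_mult_iff)
      hence "is_unit (int p)" using s True by (meson coprime_common_divisor int_dvd_int_iff)
      thus False using p(1) by simp
    next
      case False
      hence "int p dvd int q * int M" using M[OF p(1) pn] by simp
      thus False using p2 False by (simp add: dvd_add_left_iff)
    qed
  qed
  moreover have "[?t = s] (mod int q)" by (simp add: cong_def)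
  ultimately show ?thesis using that by blast
qed

text \<open>Counterpart of \<open>coprime_lift\<close>: units modulo \<open>n\<close> occur only in
  unit classes modulo \<open>q\<close>.\<close>

lemma coprime_cong_modulus_dvd:
  fixes a :: int
  assumes "[a = s] (mod int q)" "coprime a (int n)" "q dvd n"
  shows "coprime s (int q)"
proof -
  have "coprime a (int q)" using assms(2,3)
    by (metis coprime_divisors dvd_refl int_dvd_int_iff)
  thus ?thesis using assms(1) cong_imp_coprime by blast
qed

section \<open>Dirichlet characters, induced moduli and the conductor\<close>

context
  fixes n :: nat and \<chi> :: "int \<Rightarrow> complex"
  assumes chi: "dirichlet_character n \<chi>"
begin

lemma dirichlet_character_modulus_pos: "n > 0" using chi by (simp add: dirichlet_character_def)

lemma dirichlet_character_mult: "\<chi> (a * b) = \<chi> a * \<chi> b" using chi by (simp add: dirichlet_character_def)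

lemma dirichlet_character_cong: "[a = b] (mod int n) \<Longrightarrow> \<chi> a = \<chi> b"
  using chi unfolding dirichlet_character_def by blast

lemma dirichlet_character_eq_0_iff: "\<chi> a = 0 \<longleftrightarrow> \<not> coprime a (int n)"
  using chi unfolding dirichlet_character_def by blast

lemma dirichlet_character_1: "\<chi> 1 = 1"
  using dirichlet_character_mult[of 1 1] dirichlet_character_eq_0_iff[of 1] by simp

text \<open>The definition of \<open>induced_modulus\<close> only concerns the class of 1.
  Multiplying by an inverse \<open>c\<close> of \<open>b\<close> modulo \<open>n\<close> carries the
  class of \<open>b\<close> there.\<close>

lemma induced_modulus_cong:
  assumes d: "induced_modulus n \<chi> d" and "coprime a (int n)" "coprime b (int n)"
    and "[a = b] (mod int d)"
  shows "\<chi> a = \<chi> b"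
proof -
  obtain c where c: "[b * c = 1] (mod int n)"
    using assms(3) cong_solve_coprime_int by blast
  have cn: "coprime c (int n)" using c
    by (metis cong_imp_coprime cong_sym coprime_1_left coprime_mult_left_iff)
  have dn: "int d dvd int n" using d by (simp add: induced_modulus_def)
  have "[a * c = b * c] (mod int d)" using assms(4) by (rule cong_mult) simp
  also have "[b * c = 1] (mod int d)" using c dn by (rule cong_dvd_modulus)
  finally have "\<chi> (a * c) = 1" using d assms(2) cn by (auto simp: induced_modulus_def)
  moreover have "\<chi> (b * c) = 1" using dirichlet_character_cong[OF c] dirichlet_character_1 by simp
  moreover have "\<chi> c \<noteq> 0" using cn dirichlet_character_eq_0_iff by blast
  ultimately show ?thesis by (simp add: dirichlet_character_mult) (metis mult_right_cancel)
qed

text \<open>Makes the \<open>LEAST\<close> in \<open>conductor\<close> range over a nonempty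
  set.\<close>

lemma induced_modulus_self: "induced_modulus n \<chi> n"
  unfolding induced_modulus_def using dirichlet_character_cong dirichlet_character_1 by fastforce

text \<open>For a unit \<open>a\<close> congruent to 1 modulo the gcd there is a unit
  \<open>t\<close> modulo \<open>n\<close> that is 1 modulo \<open>d\<close> and \<open>a\<close>
  modulo \<open>e\<close>. The modulus \<open>d\<close> then gives \<open>\<chi> t = 1\<close>, and
  the modulus \<open>e\<close> gives \<open>\<chi> t = \<chi> a\<close>.\<close>

lemma induced_modulus_gcd:
  assumes d: "induced_modulus n \<chi> d" and e: "induced_modulus n \<chi> e"
  shows "induced_modulus n \<chi> (gcd d e)"
  unfolding induced_modulus_def
proof (intro conjI allI impI)
  show "gcd d e dvd n" using d by (auto simp: induced_modulus_def)
next
  fix a assume a: "coprime a (int n) \<and> [a = 1] (mod int (gcd d e))"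
  have dn: "d dvd n" and en: "e dvd n" using d e by (auto simp: induced_modulus_def)
  obtain x y where xy: "int d * x + int e * y = gcd (int d) (int e)"
    using bezout_int[of "int d" "int e"] by (metis mult.commute)
  obtain r where r: "a - 1 = gcd (int d) (int e) * r"
    using a by (metis cong_iff_dvd_diff dvdE gcd_int_int_eq)
  \<comment> \<open>Chinese remaindering for moduli that need not be coprime: \<open>a - 1\<close>
    equals \<open>(d * x + e * y) * r\<close>, and adding only its \<open>d\<close>-part to 1 leaves
    a difference from \<open>a\<close> that is divisible by \<open>e\<close>.\<close>
  define b where "b = 1 + int d * x * r"
  have bd: "[b = 1] (mod int d)" by (simp add: b_def cong_iff_dvd_diff)
  have "a - b = int e * (y * r)" using r xy by (simp add: b_def algebra_simps) (metis distrib_left mult.assoc mult.commute)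
  hence be: "[b = a] (mod int e)" by (metis cong_iff_dvd_diff cong_sym dvd_triv_left)
  have "coprime b (int d)" using bd by (metis cong_imp_coprime cong_sym coprime_1_left)
  moreover have "coprime b (int e)"
    using be a en by (metis coprime_cong_modulus_dvd cong_sym)
  ultimately have "coprime b (int d * int e)" by simp
  moreover have "int (lcm d e) dvd int d * int e"
    by (simp add: lcm_least flip: of_nat_mult)
  ultimately have "coprime b (int (lcm d e))" by (rule coprime_divisors[OF dvd_refl, rotated])
  \<comment> \<open>\<open>b\<close> is coprime to the lcm but perhaps not to \<open>n\<close>; the
    lift repairs this without changing its residues modulo \<open>d\<close> and
    \<open>e\<close>.\<close>
  then obtain t where t: "[t = b] (mod int (lcm d e))" "coprime t (int n)"
    using coprime_lift[OF dirichlet_character_modulus_pos, of "lcm d e" b] dn en by auto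
  have "[t = b] (mod int d)" "[t = b] (mod int e)"
    using t(1) by (meson cong_dvd_modulus dvd_lcm1 dvd_lcm2 int_dvd_int_iff)+
  hence td: "[t = 1] (mod int d)" and te: "[t = a] (mod int e)"
    using bd be cong_trans by blast+
  have "\<chi> t = 1" using d td t(2) by (simp add: induced_modulus_def)
  moreover have "\<chi> t = \<chi> a" using induced_modulus_cong[OF e t(2) _ te] a by simp
  ultimately show "\<chi> a = 1" by simp
qed

lemma induced_modulus_conductor: "induced_modulus n \<chi> (conductor n \<chi>)"
  unfolding conductor_def by (rule LeastI, rule induced_modulus_self)

text \<open>The gcd of the conductor with \<open>q\<close> is again an induced modulus, so
  minimality of the conductor forces it to equal the conductor.\<close>

lemma conductor_dvd_induced_modulus:
  assumes "induced_modulus n \<chi> q"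
  shows "conductor n \<chi> dvd q"
proof -
  let ?d = "conductor n \<chi>"
  have "?d dvd n" using induced_modulus_conductor by (simp add: induced_modulus_def)
  hence "?d > 0" using dirichlet_character_modulus_pos by (auto intro: Nat.gr0I)
  moreover have "?d \<le> gcd ?d q"
    unfolding conductor_def[of n \<chi>]
    by (rule Least_le) (use induced_modulus_gcd[OF induced_modulus_conductor assms] in \<open>simp add: conductor_def\<close>)
  ultimately have "gcd ?d q = ?d" by (meson dvd_imp_le gcd_dvd1 le_antisym)
  thus ?thesis by (metis gcd_dvd2)
qed

text \<open>Substitution of \<open>u * a\<close> for \<open>a\<close>. It serves both to compare
  different classes modulo \<open>q\<close> and, when \<open>u\<close> fixes the class, to make a
  sum vanish.\<close>

lemma sum_char_mult_unit:
  assumes q: "q dvd n" and u: "coprime u (int n)"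
  shows "(\<Sum>a | a \<in> {1..int n} \<and> [a = u * s] (mod int q). \<chi> a)
       = \<chi> u * (\<Sum>a | a \<in> {1..int n} \<and> [a = s] (mod int q). \<chi> a)"
proof -
  \<comment> \<open>The congruence condition becomes part of the summand; because \<open>q\<close>
    divides \<open>n\<close>, the result is still periodic modulo \<open>n\<close>.\<close>
  let ?f = "\<lambda>a. if [a = u * s] (mod int q) then \<chi> a else 0"
  have uq: "coprime u (int q)" using u q by (metis coprime_divisors dvd_refl int_dvd_int_iff)
  have P: "[a = u * s] (mod int q) \<longleftrightarrow> [b = u * s] (mod int q)"
    if "[a = b] (mod int n)" for a b
    using cong_dvd_modulus[OF that, of "int q"] q by (metis cong_sym cong_trans int_dvd_int_iff)
  have "(\<Sum>a | a \<in> {1..int n} \<and> [a = u * s] (mod int q). \<chi> a) = (\<Sum>a\<in>{1..int n}. ?f a)"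
    by (simp flip: sum.inter_filter)
  also have "\<dots> = (\<Sum>a\<in>{1..int n}. ?f (u * a))"
    by (rule sum_periodic_mult_unit[OF dirichlet_character_modulus_pos u, symmetric]) (use P dirichlet_character_cong in auto)
  also have "\<dots> = (\<Sum>a\<in>{1..int n}. \<chi> u * (if [a = s] (mod int q) then \<chi> a else 0))"
    using uq by (intro sum.cong) (auto simp: dirichlet_character_mult cong_mult_lcancel)
  also have "\<dots> = \<chi> u * (\<Sum>a | a \<in> {1..int n} \<and> [a = s] (mod int q). \<chi> a)"
    by (simp add: sum_distrib_left[symmetric] flip: sum.inter_filter)
  finally show ?thesis .
qed

end

section \<open>Character sums over residue classes\<close>

lemma int_totatives: "{a \<in> {1..int n}. coprime a (int n)} = int ` totatives n"
proof (intro equalityI subsetI)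
  fix a assume a: "a \<in> {a \<in> {1..int n}. coprime a (int n)}"
  then obtain b where "a = int b" using zero_le_imp_eq_int[of a] by auto
  thus "a \<in> int ` totatives n" using a by (auto simp: totatives_def)
qed (auto simp: totatives_def)

lemma card_unit_residues: "card {a \<in> {1..int n}. coprime a (int n)} = totient n"
  unfolding int_totatives totient_def by (simp add: card_image)

text \<open>With this character, counting the units in a residue class is itself a character sum, so
  \<open>sum_char_mult_unit\<close> applies to it.\<close>

definition principal_char :: "nat \<Rightarrow> int \<Rightarrow> complex" where
  "principal_char n a = (if coprime a (int n) then 1 else 0)"

lemma dirichlet_character_principal: "n > 0 \<Longrightarrow> dirichlet_character n (principal_char n)"
  unfolding dirichlet_character_def principal_char_def
  by (auto dest: cong_imp_coprime cong_sym)

text \<open>Multiplication by a lift of \<open>s\<close> carries the class of 1 to that of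
  \<open>s\<close>, so all unit classes modulo \<open>q\<close> contain equally many units modulo
  \<open>n\<close>. The \<open>totient n\<close> units are thus shared evenly among
  \<open>totient q\<close> classes.\<close>

lemma sum_principal_char:
  assumes n: "n > 0" and q: "q dvd n" and s: "coprime s (int q)"
  shows "(\<Sum>a | a \<in> {1..int n} \<and> [a = s] (mod int q). principal_char n a) = totient n / totient q"
proof -
  define N where "N s = (\<Sum>a | a \<in> {1..int n} \<and> [a = s] (mod int q). principal_char n a)" for s
  have q0: "q > 0" using n q by (auto intro: Nat.gr0I)
  have N1: "N s = N 1" if s: "coprime s (int q)" for s
  proof -
    obtain t where t: "[t = s] (mod int q)" "coprime t (int n)"
      using coprime_lift[OF n q s] .
    have "N s = N (t * 1)" unfolding N_def using t(1)
      by (intro sum.cong) (auto intro: cong_trans cong_sym)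
    also have "\<dots> = N 1" unfolding N_def
      using sum_char_mult_unit[OF dirichlet_character_principal[OF n] q t(2), of 1] t(2)
      by (simp add: principal_char_def)
    finally show ?thesis .
  qed
  let ?U = "{a \<in> {1..int n}. coprime a (int n)}" and ?T = "{a \<in> {1..int q}. coprime a (int q)}"
  have sub: "least_pos_residue q ` ?U \<subseteq> ?T"
  proof safe
    fix a assume "coprime a (int n)"
    thus "coprime (least_pos_residue q a) (int q)"
      using coprime_cong_modulus_dvd[OF cong_sym[OF least_pos_residue_cong] _ q] by blast
  qed (use least_pos_residue_mem[OF q0] in blast)
  have "of_nat (totient q) * N 1 = (\<Sum>s\<in>?T. N 1)"
    using card_unit_residues[of q] by simp
  also have "\<dots> = (\<Sum>s\<in>?T. N s)"
    by (intro sum.cong refl N1[symmetric]) simp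
  \<comment> \<open>The inner sum counts the units modulo \<open>n\<close> lying over
    \<open>s\<close>; running over all \<open>s\<close> counts every unit modulo \<open>n\<close>
    once.\<close>
  also have "\<dots> = (\<Sum>s\<in>?T. \<Sum>a | a \<in> ?U \<and> least_pos_residue q a = s. 1)"
    unfolding N_def principal_char_def
    by (rule sum.cong[OF refl], rule sum.mono_neutral_cong_right)
       (auto simp: least_pos_residue_eq_iff intro: finite_subset[of _ "{1..int n}"])
  also have "\<dots> = (\<Sum>a\<in>?U. 1)"
    by (rule sum.group[OF _ _ sub])
       (auto intro: finite_subset[of _ "{1..int n}"] finite_subset[of _ "{1..int q}"])
  also have "\<dots> = of_nat (totient n)" using card_unit_residues[of n] by simp
  finally have "of_nat (totient q) * N 1 = of_nat (totient n)" .
  thus ?thesis using N1[OF s] q0 unfolding N_def[symmetric] by (simp add: field_simps)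
qed

text \<open>A non-unit class modulo \<open>q\<close> contains no units modulo \<open>n\<close>, so
  all terms are 0. If the conductor divides \<open>q\<close>, then \<open>\<chi>'\<close> is
  constant on the class and only the count of units remains. Otherwise a suitable unit forces
  cancellation.\<close>

lemma sum_char_residue_class:
  fixes \<chi> \<chi>' :: "int \<Rightarrow> complex"
  assumes chi: "dirichlet_character n \<chi>" and ind: "induces \<chi>' n \<chi>"
    and prim: "primitive_character (conductor n \<chi>) \<chi>'" and q: "q dvd n"
  shows "(\<Sum>a | a \<in> {1..int n} \<and> [a = s] (mod int q). \<chi> a)
       = (if conductor n \<chi> dvd q \<and> coprime s (int q)
          then totient n / totient q * \<chi>' s else 0)"
proof -
  let ?A = "{a. a \<in> {1..int n} \<and> [a = s] (mod int q)}"
  let ?d = "conductor n \<chi>"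
  consider "\<not> coprime s (int q)" | "coprime s (int q)" "?d dvd q" | "coprime s (int q)" "\<not> ?d dvd q"
    by blast
  thus ?thesis
  proof cases
    case 1
    have "\<chi> a = 0" if "a \<in> ?A" for a
      using that 1 coprime_cong_modulus_dvd[OF _ _ q] dirichlet_character_eq_0_iff[OF chi] by auto
    thus ?thesis using 1 by simp
  next
    case 2
    have "\<chi> a = \<chi>' s * principal_char n a" if "a \<in> ?A" for a
    proof -
      have "[a = s] (mod int ?d)" using that 2(2) by (auto intro: cong_dvd_modulus)
      hence "\<chi>' a = \<chi>' s" using prim dirichlet_character_cong unfolding primitive_character_def by blast
      thus ?thesis using ind by (simp add: induces_def principal_char_def)
    qed
    hence "(\<Sum>a\<in>?A. \<chi> a) = \<chi>' s * (\<Sum>a\<in>?A. principal_char n a)"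
      by (simp add: sum_distrib_left)
    thus ?thesis using 2 sum_principal_char[OF dirichlet_character_modulus_pos[OF chi] q 2(1)] by simp
  next
    case 3
    hence "\<not> induced_modulus n \<chi> q" using conductor_dvd_induced_modulus[OF chi] by blast
    then obtain u where u: "coprime u (int n)" "[u = 1] (mod int q)" "\<chi> u \<noteq> 1"
      using q by (auto simp: induced_modulus_def)
    \<comment> \<open>As \<open>u\<close> fixes the class of \<open>s\<close>, the sum equals
      \<open>\<chi> u\<close> times itself, with \<open>\<chi> u \<noteq> 1\<close>.\<close>
    have "[u * s = s] (mod int q)" using cong_mult[OF u(2), of s s] by simp
    hence "?A = {a. a \<in> {1..int n} \<and> [a = u * s] (mod int q)}"
      by (auto intro: cong_trans cong_sym)
    hence "(\<Sum>a\<in>?A. \<chi> a) = \<chi> u * (\<Sum>a\<in>?A. \<chi> a)"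
      using sum_char_mult_unit[OF chi q u(1), of s] by simp
    hence "(\<Sum>a\<in>?A. \<chi> a) = 0" using u(3) unfolding mult_cancel_right1 by blast
    thus ?thesis by (simp only: 3 simp_thms if_False)
  qed
qed

section \<open>Sums of additive characters over multiples of \<open>q\<close>\<close>

text \<open>Decides when the ratio of the geometric sum below is 1; the case \<open>e = 1\<close>
  shows that this ratio is a root of unity.\<close>

lemma exp_2pi_int_div_eq_1_iff:
  assumes "e > 0"
  shows "exp (2 * of_real pi * \<i> * of_int w / of_nat e) = 1 \<longleftrightarrow> int e dvd w"
proof -
  have "exp (2 * of_real pi * \<i> * of_int w / of_nat e) = cis (2 * pi * (of_int w / of_nat e))"
    by (simp add: cis_conv_exp mult_ac)
  also have "\<dots> = 1 \<longleftrightarrow> (\<exists>x::int. of_int w / of_nat e = (of_int x :: real))"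
  proof -
    have "cis (2 * pi * y) = 1 \<longleftrightarrow> (\<exists>x::int. y = of_int x)" for y
      by (auto simp: complex_eq_iff sin_times_pi_eq_0 cos_one_2pi_int)
    thus ?thesis .
  qed
  also have "\<dots> \<longleftrightarrow> (\<exists>x::int. w = int e * x)"
  proof -
    have "of_int w / of_nat e = (of_int x :: real) \<longleftrightarrow> w = int e * x" for x
    proof -
      have "of_int w / of_nat e = (of_int x :: real) \<longleftrightarrow> (of_int w :: real) = of_int (int e * x)"
        using assms by (simp add: field_simps)
      thus ?thesis by (simp only: of_int_eq_iff)
    qed
    thus ?thesis by simp
  qed
  finally show ?thesis by (simp add: dvd_def)
qed

text \<open>With \<open>n = q * e\<close> and \<open>b = q * c\<close> the factor \<open>q\<close>
  cancels in the exponent, leaving the powers of an \<open>e\<close>-th root of unity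
  \<open>z\<close> over one full period.\<close>

lemma sum_exp_multiples:
  assumes n: "n > 0" and q: "q dvd n"
  shows "(\<Sum>b | b \<in> {1..int n} \<and> int q dvd b.
            exp (2 * of_real pi * \<i> * of_int w * of_int b / of_nat n))
       = (if int (n div q) dvd w then of_nat (n div q) else 0)"
proof -
  obtain e where e: "n = q * e" using q by blast
  have e0: "e > 0" and q0: "q > 0" using n e by auto
  define z where "z = exp (2 * of_real pi * \<i> * of_int w / of_nat e)"
  have ze: "z ^ e = 1"
  proof -
    have "z ^ e = exp (2 * of_real pi * \<i> * of_int w / of_nat 1)"
      using e0 unfolding z_def by (simp add: exp_of_nat_mult[symmetric])
    thus ?thesis using exp_2pi_int_div_eq_1_iff[of 1 w] by simp
  qed
  have "(\<Sum>b | b \<in> {1..int n} \<and> int q dvd b.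
            exp (2 * of_real pi * \<i> * of_int w * of_int b / of_nat n)) = (\<Sum>c\<in>{1..e}. z ^ c)"
  proof (rule sum.reindex_bij_witness[where i = "\<lambda>c. int (q * c)" and j = "\<lambda>b. nat (b div int q)"])
    fix b assume b: "b \<in> {b. b \<in> {1..int n} \<and> int q dvd b}"
    then obtain c where c: "b = int q * c" by blast
    with b q0 e have c': "1 \<le> c" "c \<le> int e"
      by (auto simp: zero_less_mult_iff int_one_le_iff_zero_less)
    then obtain c0 where c0: "c = int c0" using zero_le_imp_eq_int[of c] by auto
    show "int (q * nat (b div int q)) = b" "nat (b div int q) \<in> {1..e}" using c c' c0 q0 by auto
    show "z ^ nat (b div int q) = exp (2 * of_real pi * \<i> * of_int w * of_int b / of_nat n)"
      using c c0 q0 e0 unfolding z_def e by (simp add: exp_of_nat_mult[symmetric] field_simps)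
  next
    fix c assume "c \<in> {1..e}"
    show "nat (int (q * c) div int q) = c" using q0 by simp
    show "int (q * c) \<in> {b. b \<in> {1..int n} \<and> int q dvd b}"
      using q0 e \<open>c \<in> {1..e}\<close> by (auto simp flip: of_nat_mult simp: Suc_le_eq int_one_le_iff_zero_less)
  qed
  also have "\<dots> = (if z = 1 then of_nat e else 0)"
  proof (cases "z = 1")
    case False
    \<comment> \<open>Extracting one factor \<open>z\<close> shifts the exponents to start at 0, as
      \<open>geometric_sum\<close> requires.\<close>
    have "(\<Sum>c\<in>{1..e}. z ^ c) = z * (\<Sum>c<e. z ^ c)"
      by (simp add: sum_distrib_left sum.atLeast1_atMost_eq)
    also have "(\<Sum>c<e. z ^ c) = 0" using False ze by (simp add: geometric_sum)
    finally show ?thesis using False by simp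
  qed simp
  finally show ?thesis using exp_2pi_int_div_eq_1_iff[OF e0] q0 e by (simp add: z_def)
qed

section \<open>The Moebius function and Moebius inversion\<close>

lemma moebius_mu_prime_mult:
  assumes p: "prime p" and d: "\<not> p dvd d"
  shows "moebius_mu (p * d) = - moebius_mu d"
proof (cases "squarefree d")
  case True
  have cop: "coprime p d" using p d by (simp add: prime_imp_coprime)
  have sq: "squarefree (p * d)" using True cop p by (simp add: squarefree_mult_coprime squarefree_prime)
  have d0: "d \<noteq> 0" using d by (rule contrapos_nn) simp
  have "prime_factors (p * d) = insert p (prime_factors d)"
    using p d0 by (subst prime_factors_product) (auto simp: prime_factorization_prime)
  moreover have "p \<notin> prime_factors d" using d by auto
  ultimately show ?thesis using True sq by (simp add: moebius_mu_def)
next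
  case False
  hence "\<not> squarefree (p * d)" by (metis dvd_triv_right squarefree_mono)
  thus ?thesis using False by (simp add: moebius_mu_def)
qed

lemma moebius_mu_prime_square_mult:
  assumes "prime p" "p dvd d"
  shows "moebius_mu (p * d) = 0"
proof -
  have "p\<^sup>2 dvd p * d" using assms(2) by (simp add: power2_eq_square)
  hence "\<not> squarefree (p * d)" using assms(1) by (meson not_prime_unit squarefreeD)
  thus ?thesis by (simp add: moebius_mu_def)
qed

text \<open>For a prime \<open>p\<close> dividing \<open>n\<close>, each divisor \<open>d\<close>
  prime to \<open>p\<close> cancels against \<open>p * d\<close>; the divisors divisible by the
  square of \<open>p\<close> contribute 0.\<close>

lemma sum_moebius_mu_divisors:
  assumes n: "n > 0"
  shows "(\<Sum>d | d dvd n. moebius_mu d) = (if n = 1 then 1 else 0)"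
proof (cases "n = 1")
  case True thus ?thesis by (simp add: moebius_mu_def)
next
  case False
  then obtain p where p: "prime p" "p dvd n" using prime_factor_nat by blast
  let ?A = "{d. d dvd n \<and> \<not> p dvd d}" and ?B = "{d. d dvd n \<and> p dvd d}"
  have p0: "p > 0" using p by (simp add: prime_gt_0_nat)
  obtain r where r: "n = p * r" using p by blast
  have fin: "finite {d. d dvd n}" using n by simp
  have "?B = (*) p ` {d. d dvd r}" unfolding r using p0 by (auto simp: image_iff elim!: dvdE)
  hence "(\<Sum>d\<in>?B. moebius_mu d) = (\<Sum>d | d dvd r. moebius_mu (p * d))"
    using p0 by (simp add: sum.reindex inj_on_def)
  also have "\<dots> = (\<Sum>d\<in>?A. - moebius_mu d)"
  \<comment> \<open>The index sets may differ: \<open>?A\<close> lies inside the divisors of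
    \<open>r\<close>, and a divisor of \<open>r\<close> outside \<open>?A\<close> is a multiple of
    \<open>p\<close>, where the summand vanishes.\<close>
  proof (rule sum.mono_neutral_cong)
    fix d assume "d \<in> ?A - {d. d dvd r}"
    moreover from this have "coprime d p"
      using p(1) prime_imp_coprime[of p d] by (simp add: coprime_commute)
    ultimately have False unfolding r by (auto simp: coprime_dvd_mult_right_iff)
    thus "- moebius_mu d = 0" ..
  next
    fix d assume "d \<in> {d. d dvd r} - ?A"
    hence "p dvd d" unfolding r by auto
    thus "moebius_mu (p * d) = 0" by (rule moebius_mu_prime_square_mult[OF p(1)])
  next
    fix d assume "d \<in> {d. d dvd r} \<inter> ?A"
    thus "moebius_mu (p * d) = - moebius_mu d" using moebius_mu_prime_mult[OF p(1)] by blast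
  next
    have "r > 0" using n r by auto
    thus "finite {d. d dvd r}" by simp
  qed (rule finite_subset[OF _ fin], blast)
  finally have B: "(\<Sum>d\<in>?B. moebius_mu d) = (\<Sum>d\<in>?A. - moebius_mu d)" .
  have "(\<Sum>d | d dvd n. moebius_mu d) = (\<Sum>d\<in>?A \<union> ?B. moebius_mu d)"
    by (rule sum.cong) auto
  also have "\<dots> = (\<Sum>d\<in>?A. moebius_mu d) + (\<Sum>d\<in>?B. moebius_mu d)"
    using finite_subset[OF _ fin, of ?A] finite_subset[OF _ fin, of ?B]
    by (intro sum.union_disjoint) blast+
  finally show ?thesis using B False by (simp add: sum_negf)
qed

text \<open>Writing \<open>q = f * c\<close> and summing over \<open>c\<close> first leaves the
  divisor sum of the Moebius function at \<open>g div f\<close>, which selects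
  \<open>f = g\<close>.\<close>

lemma moebius_inversion:
  assumes g: "g > 0"
  shows "(\<Sum>q | q dvd g. dirichlet_conv moebius_mu F q) = F g"
proof -
  have "(\<Sum>q | q dvd g. dirichlet_conv moebius_mu F q)
      = (\<Sum>(q, c)\<in>(SIGMA q:{q. q dvd g}. {c. c dvd q}). moebius_mu c * F (q div c))"
    unfolding dirichlet_conv_def using g by (subst sum.Sigma) (auto simp: dvd_pos_nat)
  also have "\<dots> = (\<Sum>(f, c)\<in>(SIGMA f:{f. f dvd g}. {c. c dvd g div f}). moebius_mu c * F f)"
    by (rule sum.reindex_bij_witness[where i = "\<lambda>(f, c). (f * c, c)" and j = "\<lambda>(q, c). (q div c, c)"])
       (use g in \<open>auto elim!: dvdE\<close>)
  also have "\<dots> = (\<Sum>f | f dvd g. F f * (\<Sum>c | c dvd g div f. moebius_mu c))"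
    using g by (subst sum.Sigma[symmetric]) (auto simp: sum_distrib_left mult.commute elim!: dvdE)
  also have "\<dots> = (\<Sum>f | f dvd g. if f = g then F g else 0)"
    using g by (intro sum.cong refl, subst sum_moebius_mu_divisors) (auto elim!: dvdE)
  also have "\<dots> = F g" using g by (simp add: sum.delta)
  finally show ?thesis .
qed

section \<open>Expansion of the gcd and proof of the identity\<close>

lemma prod_if_zero:
  fixes f :: "'a \<Rightarrow> 'b::comm_semiring_1"
  assumes "finite A"
  shows "(\<Prod>x\<in>A. if P x then f x else 0) = (if \<forall>x\<in>A. P x then \<Prod>x\<in>A. f x else 0)"
  using assms by (induction) auto

text \<open>Moebius inversion at the gcd. The condition on \<open>X\<close> is kept inside the
  summand so that the index set depends on \<open>n\<close> alone and the sums can be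
  exchanged.\<close>

lemma Gcd_expansion:
  fixes n :: nat and X :: "int set"
  assumes "n > 0"
  shows "F (nat (Gcd (X \<union> {int n})))
       = (\<Sum>q | q dvd n. if \<forall>x\<in>X. int q dvd x then dirichlet_conv moebius_mu F q else 0)"
proof -
  let ?g = "nat (Gcd (X \<union> {int n}))"
  have g: "int ?g = Gcd (X \<union> {int n})" by (simp add: Gcd_int_greater_eq_0)
  \<comment> \<open>The member \<open>n\<close> keeps the gcd nonzero even if all of
    \<open>X\<close> is zero.\<close>
  have "?g > 0" using assms by (intro Nat.gr0I) (auto simp: nat_eq_iff Gcd_0_iff)
  hence "F ?g = (\<Sum>q | q dvd ?g. dirichlet_conv moebius_mu F q)"
    by (simp add: moebius_inversion)
  also have "{q. q dvd ?g} = {q. q dvd n \<and> (\<forall>x\<in>X. int q dvd x)}"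
  proof -
    have "q dvd ?g \<longleftrightarrow> int q dvd Gcd (X \<union> {int n})" for q using g by (metis int_dvd_int_iff)
    thus ?thesis by (simp only: dvd_Gcd_iff) auto
  qed
  also have "(\<Sum>q\<in>\<dots>. dirichlet_conv moebius_mu F q)
      = (\<Sum>q | q dvd n. if \<forall>x\<in>X. int q dvd x then dirichlet_conv moebius_mu F q else 0)"
    using assms by (simp flip: sum.inter_filter)
  finally show ?thesis .
qed

theorem theorem1p2:
  fixes n m k :: nat
    and F :: "nat \<Rightarrow> complex"
    and s w :: "nat \<Rightarrow> int"
    and d :: "nat \<Rightarrow> nat"
    and \<chi> \<chi>' :: "nat \<Rightarrow> int \<Rightarrow> complex"
    and \<Lambda> :: "nat \<Rightarrow> int \<Rightarrow> complex"
  assumes "n > 0" and "m > 0" and "k > 0"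
    and "\<And>j. j \<in> {1..m} \<Longrightarrow> dirichlet_character n (\<chi> j)"
    and "\<And>j. j \<in> {1..m} \<Longrightarrow> d j = conductor n (\<chi> j)"
    and "\<And>j. j \<in> {1..m} \<Longrightarrow> primitive_character (d j) (\<chi>' j)"
    and "\<And>j. j \<in> {1..m} \<Longrightarrow> induces (\<chi>' j) n (\<chi> j)"
    and "\<And>l b. l \<in> {1..k} \<Longrightarrow>
           \<Lambda> l b = exp (2 * of_real pi * \<i> * of_int (w l) * of_int b / of_nat n)"
  shows
    "(\<Sum>a \<in> {1..m} \<rightarrow>\<^sub>E {1..int n}. \<Sum>b \<in> {1..k} \<rightarrow>\<^sub>E {1..int n}.
        F (nat (Gcd ((\<lambda>j. a j - s j) ` {1..m} \<union> b ` {1..k} \<union> {int n})))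
        * (\<Prod>j = 1..m. \<chi> j (a j)) * (\<Prod>l = 1..k. \<Lambda> l (b l)))
     = of_nat (totient n) ^ m * (\<Prod>j = 1..m. \<chi>' j (s j)) *
       (\<Sum>e | e > 0 \<and> int e dvd Gcd ((\<lambda>j. int (n div d j)) ` {1..m} \<union> w ` {1..k})
              \<and> coprime (int (n div e)) (\<Prod>j = 1..m. s j).
          of_nat e ^ k * dirichlet_conv moebius_mu F (n div e)
          / of_nat (totient (n div e)) ^ m)"
proof -
  let ?I = "{1..int n}" and ?c = "dirichlet_conv moebius_mu F"
  let ?D = "{q. q dvd n}"
  \<comment> \<open>\<open>A\<close> and \<open>B\<close> absorb the divisibility conditions on the
    single variables, and \<open>P\<close> gathers the conditions under which the closed forms of
    all one-variable sums take their nonzero branch.\<close>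
  define A where "A q j x = (if [x = s j] (mod int q) then \<chi> j x else 0)" for q j x
  define B where "B q l x = (if int q dvd x then \<Lambda> l x else 0)" for q l x
  define P where "P q \<longleftrightarrow> (\<forall>j\<in>{1..m}. d j dvd q \<and> coprime (s j) (int q))
      \<and> (\<forall>l\<in>{1..k}. int (n div q) dvd w l)" for q
  have term_eq: "F (nat (Gcd ((\<lambda>j. a j - s j) ` {1..m} \<union> b ` {1..k} \<union> {int n})))
        * (\<Prod>j = 1..m. \<chi> j (a j)) * (\<Prod>l = 1..k. \<Lambda> l (b l))
      = (\<Sum>q\<in>?D. ?c q * (\<Prod>j = 1..m. A q j (a j)) * (\<Prod>l = 1..k. B q l (b l)))" for a b
    unfolding Gcd_expansion[OF assms(1)] sum_distrib_right A_def B_def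
    by (intro sum.cong) (auto simp: prod_if_zero cong_iff_dvd_diff)
  have "(\<Sum>a \<in> {1..m} \<rightarrow>\<^sub>E ?I. \<Sum>b \<in> {1..k} \<rightarrow>\<^sub>E ?I.
        F (nat (Gcd ((\<lambda>j. a j - s j) ` {1..m} \<union> b ` {1..k} \<union> {int n})))
        * (\<Prod>j = 1..m. \<chi> j (a j)) * (\<Prod>l = 1..k. \<Lambda> l (b l)))
      = (\<Sum>a \<in> {1..m} \<rightarrow>\<^sub>E ?I. \<Sum>q\<in>?D. \<Sum>b \<in> {1..k} \<rightarrow>\<^sub>E ?I.
          ?c q * (\<Prod>j = 1..m. A q j (a j)) * (\<Prod>l = 1..k. B q l (b l)))"
    unfolding term_eq by (intro sum.cong refl sum.swap)
  also have "\<dots> = (\<Sum>q\<in>?D. \<Sum>a \<in> {1..m} \<rightarrow>\<^sub>E ?I. \<Sum>b \<in> {1..k} \<rightarrow>\<^sub>E ?I.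
          ?c q * (\<Prod>j = 1..m. A q j (a j)) * (\<Prod>l = 1..k. B q l (b l)))"
    by (rule sum.swap)
  \<comment> \<open>For fixed \<open>q\<close> the variables are separated, so
    \<open>prod_sum_PiE\<close> identifies the multiple sum with a product of one-variable
    sums.\<close>
  also have "\<dots> = (\<Sum>q\<in>?D. ?c q * (\<Prod>j = 1..m. \<Sum>x\<in>?I. A q j x) * (\<Prod>l = 1..k. \<Sum>x\<in>?I. B q l x))"
    by (intro sum.cong refl)
       (simp add: prod_sum_PiE sum_distrib_left sum_distrib_right mult.assoc, rule sum.swap)
  also have "\<dots> = (\<Sum>q\<in>?D. if P q then of_nat (totient n) ^ m * (\<Prod>j = 1..m. \<chi>' j (s j)) *
          (of_nat (n div q) ^ k * ?c q / of_nat (totient q) ^ m) else 0)"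
  proof (intro sum.cong refl)
    fix q assume q: "q \<in> ?D"
    have "(\<Prod>j = 1..m. \<Sum>x\<in>?I. A q j x)
        = (\<Prod>j = 1..m. if d j dvd q \<and> coprime (s j) (int q)
             then totient n / totient q * \<chi>' j (s j) else 0)"
    proof (intro prod.cong refl)
      fix j assume j: "j \<in> {1..m}"
      have "(\<Sum>x\<in>?I. A q j x) = (\<Sum>x | x \<in> ?I \<and> [x = s j] (mod int q). \<chi> j x)"
        unfolding A_def by (rule sum.inter_filter[symmetric]) simp
      thus "(\<Sum>x\<in>?I. A q j x) = (if d j dvd q \<and> coprime (s j) (int q)
             then totient n / totient q * \<chi>' j (s j) else 0)"
        using sum_char_residue_class[of n "\<chi> j" "\<chi>' j" q "s j"] assms(4-7)[OF j] q by simp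
    qed
    moreover have "(\<Prod>l = 1..k. \<Sum>x\<in>?I. B q l x)
        = (\<Prod>l = 1..k. if int (n div q) dvd w l then of_nat (n div q) else 0)"
    proof (intro prod.cong refl)
      fix l assume l: "l \<in> {1..k}"
      have "(\<Sum>x\<in>?I. B q l x) = (\<Sum>x | x \<in> ?I \<and> int q dvd x. \<Lambda> l x)"
        unfolding B_def by (rule sum.inter_filter[symmetric]) simp
      thus "(\<Sum>x\<in>?I. B q l x) = (if int (n div q) dvd w l then of_nat (n div q) else 0)"
        using sum_exp_multiples[OF assms(1), of q "w l"] assms(8)[OF l] q by simp
    qed
    ultimately show "?c q * (\<Prod>j = 1..m. \<Sum>x\<in>?I. A q j x) * (\<Prod>l = 1..k. \<Sum>x\<in>?I. B q l x)
        = (if P q then of_nat (totient n) ^ m * (\<Prod>j = 1..m. \<chi>' j (s j)) *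
          (of_nat (n div q) ^ k * ?c q / of_nat (totient q) ^ m) else 0)"
      by (simp only: prod_if_zero finite_atLeastAtMost P_def)
         (simp add: prod.distrib prod_dividef power_divide)
  qed
  also have "\<dots> = of_nat (totient n) ^ m * (\<Prod>j = 1..m. \<chi>' j (s j)) *
      (\<Sum>q | q \<in> ?D \<and> P q. of_nat (n div q) ^ k * ?c q / of_nat (totient q) ^ m)"
    unfolding sum_distrib_left by (rule sum.inter_filter[symmetric]) (use assms(1) in simp)
  also have "(\<Sum>q | q \<in> ?D \<and> P q. of_nat (n div q) ^ k * ?c q / of_nat (totient q) ^ m)
      = (\<Sum>e | e > 0 \<and> int e dvd Gcd ((\<lambda>j. int (n div d j)) ` {1..m} \<union> w ` {1..k})
              \<and> coprime (int (n div e)) (\<Prod>j = 1..m. s j).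
          of_nat e ^ k * ?c (n div e) / of_nat (totient (n div e)) ^ m)"
  proof -
    have dn: "d j dvd n" if "j \<in> {1..m}" for j
      using induced_modulus_conductor[OF assms(4)[OF that]] assms(5)[OF that]
      by (simp add: induced_modulus_def)
    \<comment> \<open>Both sides say that \<open>e * d j\<close> divides \<open>n\<close>.\<close>
    have flip: "e dvd n div d j \<longleftrightarrow> d j dvd n div e" if "j \<in> {1..m}" "e dvd n" for e j
    proof -
      have "d j \<noteq> 0" "e \<noteq> 0" using dn[OF that(1)] that(2) assms(1) by (auto intro!: gr0I)
      thus ?thesis using dn[OF that(1)] that(2) by (simp add: dvd_div_iff_mult mult.commute)
    qed
    have dvd_Gcd: "int e dvd Gcd ((\<lambda>j. int (n div d j)) ` {1..m} \<union> w ` {1..k})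
        \<longleftrightarrow> (\<forall>j\<in>{1..m}. e dvd n div d j) \<and> (\<forall>l\<in>{1..k}. int e dvd w l)" for e
      unfolding dvd_Gcd_iff ball_Un ball_simps int_dvd_int_iff ..
    have cond: "int e dvd Gcd ((\<lambda>j. int (n div d j)) ` {1..m} \<union> w ` {1..k})
        \<and> coprime (int (n div e)) (\<Prod>j = 1..m. s j) \<longleftrightarrow> P (n div e)" if "e dvd n" for e
    proof -
      have "n div (n div e) = e" using that assms(1) by auto
      moreover have "coprime (int (n div e)) (\<Prod>j = 1..m. s j)
          \<longleftrightarrow> (\<forall>j\<in>{1..m}. coprime (s j) (int (n div e)))"
      proof
        assume c: "coprime (int (n div e)) (\<Prod>j = 1..m. s j)"
        show "\<forall>j\<in>{1..m}. coprime (s j) (int (n div e))"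
        proof
          fix j assume "j \<in> {1..m}"
          hence "s j dvd (\<Prod>j = 1..m. s j)" by (intro dvd_prodI) auto
          thus "coprime (s j) (int (n div e))"
            using c by (rule coprime_divisors[OF _ dvd_refl coprime_commute[THEN iffD1]])
        qed
      qed (rule prod_coprime_right, simp add: coprime_commute)
      ultimately show ?thesis using flip[OF _ that] unfolding dvd_Gcd P_def by auto
    qed
    \<comment> \<open>Since \<open>m > 0\<close>, the entry \<open>n div d 1\<close> is present
      among the arguments of the \<open>Gcd\<close> and confines \<open>e\<close> to the divisors of
      \<open>n\<close>.\<close>
    have en: "e dvd n" if "int e dvd Gcd ((\<lambda>j. int (n div d j)) ` {1..m} \<union> w ` {1..k})" for e
    proof -
      have "e dvd n div d 1" using that assms(2) unfolding dvd_Gcd by simp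
      also have "n div d 1 dvd n"
        using dn[of 1] assms(2) by (metis One_nat_def Suc_leI atLeastAtMost_iff dvd_div_mult_self dvd_triv_left le_refl)
      finally show ?thesis .
    qed
    show ?thesis
    \<comment> \<open>Passing to the complementary divisor is an involution on the divisors of
      \<open>n\<close>; \<open>cond\<close> matches the two sets of conditions.\<close>
    proof (rule sum.reindex_bij_witness[where i = "\<lambda>e. n div e" and j = "\<lambda>q. n div q"])
      fix q assume q: "q \<in> {q. q \<in> ?D \<and> P q}"
      show inv: "n div (n div q) = q" using q assms(1) by auto
      have "n div q dvd n" "n div q > 0" using q assms(1)
        by (auto simp: div_greater_zero_iff dvd_imp_le dvd_pos_nat)
      thus "n div q \<in> {e. e > 0 \<and> int e dvd Gcd ((\<lambda>j. int (n div d j)) ` {1..m} \<union> w ` {1..k})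
              \<and> coprime (int (n div e)) (\<Prod>j = 1..m. s j)}"
        using cond[of "n div q"] q inv by simp
      show "of_nat (n div q) ^ k * ?c (n div (n div q)) / of_nat (totient (n div (n div q))) ^ m
          = of_nat (n div q) ^ k * ?c q / of_nat (totient q) ^ m" by (simp only: inv)
    next
      fix e assume e: "e \<in> {e. e > 0 \<and> int e dvd Gcd ((\<lambda>j. int (n div d j)) ` {1..m} \<union> w ` {1..k})
              \<and> coprime (int (n div e)) (\<Prod>j = 1..m. s j)}"
      hence e': "e dvd n" using en by blast
      thus "n div (n div e) = e" using assms(1) by auto
      show "n div e \<in> {q. q \<in> ?D \<and> P q}" using cond[OF e'] e e' by auto
    qed
  qed
  finally show ?thesis .
qed

end
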